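(* Let $n$ be an odd positive integer, let $H=\{x\in\mathbb{R}^n : 2\sum_{i=1}^n x_i\le n\}$, and let $C=H\cap[0,1]^n$. Consider the pure integer problem $\max\{\sum_{i=1}^{\lceil n/2\rceil}x_i : x\in C\cap\mathbb{Z}^n\}$. Its optimal value is $\lfloor n/2\rfloor$, and there is a branch-and-bound algorithm based on variable disjunctions (i.e., the family of split disjunctions with sparsity $1$) that certifies $\sum_{i=1}^{\lceil n/2\rceil}x_i\le\lfloor n/2\rfloor$ in $O(n)$ steps (i.e., with a branch-and-bound tree having $O(n)$ nodes). However, any cutting plane for $C$ with sparsity $s\le\lfloor n/2\rfloor$ is trivial, i.e., valid for $[0,1]^n$, no matter what cutting plane paradigm is used to derive it: every halfspace $\{x\in\mathbb{R}^n:\langle a,x\rangle\le\delta\}$ that contains $C\cap\mathbb{Z}^n$ and whose normal $a$ has at most $\lfloor n/2\rfloor$ non-zero entries contains $[0,1]^n$.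
   Context: A variable disjunction in $\mathbb{R}^n$ is a union $\{x: x_i\le\pi_0\}\cup\{x:x_i\ge\pi_0+1\}$ with $i\in\{1,\dots,n\}$ and $\pi_0\in\mathbb{Z}$. A branch-and-bound tree based on a family of disjunctions $Q_1\cup\dots\cup Q_k\supseteq\mathbb{Z}^n$ is a finite rooted tree whose nodes are convex subsets of $C$: the root is $C$, and each non-leaf node $N$ has as children $Q_1\cap N,\dots,Q_k\cap N$ for some disjunction in the family. It certifies $\langle c,x\rangle\le\gamma$ if this inequality is valid for every leaf (empty leaves satisfy this vacuously). A cutting plane for $C$ is a halfspace $\{x\in\mathbb{R}^n:\langle a,x\rangle\le\delta\}$ containing $C\cap\mathbb{Z}^n$; it has sparsity $s$ if it can be represented by an inequality with at most $s$ non-zero coefficients. A cutting plane paradigm is any function assigning to each closed convex set $C$ a family of cutting planes for $C$. *)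

theory Defs
  imports "HOL-Analysis.Analysis"
begin

text \<open>
  The dimension \<open>n\<close> has to vary inside the statement (the implied constant in \<open>O(n)\<close> must not
  depend on it), so \<open>\<real>\<^sup>n\<close> is the library's \<^const>\<open>Euclidean_space\<close>: its points are the functions
  \<open>x :: nat \<Rightarrow> real\<close> with \<open>x i = 0\<close> for all \<open>i \<ge> n\<close>, and the coordinates are \<open>x 0, \<dots>, x (n - 1)\<close>.
\<close>

abbreviation Rn :: "nat \<Rightarrow> (nat \<Rightarrow> real) set"
  where "Rn n \<equiv> topspace (Euclidean_space n)"

definition Zn :: "nat \<Rightarrow> (nat \<Rightarrow> real) set"
  where "Zn n = {x \<in> Rn n. \<forall>i<n. x i \<in> \<int>}"

definition inner_n :: "nat \<Rightarrow> (nat \<Rightarrow> real) \<Rightarrow> (nat \<Rightarrow> real) \<Rightarrow> real"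
  where "inner_n n a x = (\<Sum>i<n. a i * x i)"

text \<open>The library's \<^const>\<open>convex\<close>, restated because the function type carries no vector space structure.\<close>

definition convex_n :: "(nat \<Rightarrow> real) set \<Rightarrow> bool"
  where "convex_n S \<longleftrightarrow>
    (\<forall>x\<in>S. \<forall>y\<in>S. \<forall>u\<ge>0. \<forall>v\<ge>0. u + v = 1 \<longrightarrow> (\<lambda>i. u * x i + v * y i) \<in> S)"

definition halfspace :: "nat \<Rightarrow> (nat \<Rightarrow> real) \<Rightarrow> real \<Rightarrow> (nat \<Rightarrow> real) set"
  where "halfspace n a \<delta> = {x \<in> Rn n. inner_n n a x \<le> \<delta>}"

definition unit_cube :: "nat \<Rightarrow> (nat \<Rightarrow> real) set"
  where "unit_cube n = {x \<in> Rn n. \<forall>i<n. 0 \<le> x i \<and> x i \<le> 1}"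


subsection \<open>Branch-and-bound trees\<close>

text \<open>A disjunction \<open>Q\<^sub>1 \<union> \<dots> \<union> Q\<^sub>k\<close> is the list of its terms.\<close>

definition disjunction :: "nat \<Rightarrow> (nat \<Rightarrow> real) set list \<Rightarrow> bool"
  where "disjunction n Qs \<longleftrightarrow> Zn n \<subseteq> \<Union>(set Qs)"

definition variable_disjunctions :: "nat \<Rightarrow> (nat \<Rightarrow> real) set list set"
  where "variable_disjunctions n =
    {[{x \<in> Rn n. x i \<le> of_int \<pi>\<^sub>0}, {x \<in> Rn n. x i \<ge> of_int \<pi>\<^sub>0 + 1}] | i (\<pi>\<^sub>0 :: int). i < n}"

datatype 'a rtree = Node (root: 'a) (children: "'a rtree list")

fun node_count :: "'a rtree \<Rightarrow> nat"
  where "node_count (Node N ts) = 1 + sum_list (map node_count ts)"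

fun leaves :: "'a rtree \<Rightarrow> 'a set"
  where "leaves (Node N ts) = (if ts = [] then {N} else (\<Union>t\<in>set ts. leaves t))"

fun branches_by :: "(nat \<Rightarrow> real) set list set \<Rightarrow> (nat \<Rightarrow> real) set rtree \<Rightarrow> bool"
  where "branches_by \<D> (Node N ts) \<longleftrightarrow>
    (ts \<noteq> [] \<longrightarrow> (\<exists>Qs\<in>\<D>. map root ts = map (\<lambda>Q. Q \<inter> N) Qs)) \<and>
    (\<forall>t\<in>set ts. branches_by \<D> t)"

definition bb_tree ::
    "nat \<Rightarrow> (nat \<Rightarrow> real) set list set \<Rightarrow> (nat \<Rightarrow> real) set \<Rightarrow> (nat \<Rightarrow> real) set rtree \<Rightarrow> bool"
  where "bb_tree n \<D> C T \<longleftrightarrow>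
    (\<forall>Qs\<in>\<D>. disjunction n Qs) \<and>
    root T = C \<and>
    (\<forall>N\<in>set_rtree T. convex_n N \<and> N \<subseteq> C) \<and>
    branches_by \<D> T"

definition certifies :: "nat \<Rightarrow> (nat \<Rightarrow> real) set rtree \<Rightarrow> (nat \<Rightarrow> real) \<Rightarrow> real \<Rightarrow> bool"
  where "certifies n T c \<gamma> \<longleftrightarrow> (\<forall>N\<in>leaves T. \<forall>x\<in>N. inner_n n c x \<le> \<gamma>)"


subsection \<open>Cutting planes\<close>

text \<open>
  The degenerate normal \<open>a = 0\<close> is not excluded: the whole space then counts as a cutting plane,
  which only enlarges the class that the theorem quantifies over.
\<close>

definition cutting_plane :: "nat \<Rightarrow> (nat \<Rightarrow> real) set \<Rightarrow> (nat \<Rightarrow> real) set \<Rightarrow> bool"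
  where "cutting_plane n C F \<longleftrightarrow> (\<exists>a\<in>Rn n. \<exists>\<delta>. F = halfspace n a \<delta>) \<and> C \<inter> Zn n \<subseteq> F"

definition has_sparsity :: "nat \<Rightarrow> nat \<Rightarrow> (nat \<Rightarrow> real) set \<Rightarrow> bool"
  where "has_sparsity n s F \<longleftrightarrow>
    (\<exists>a\<in>Rn n. \<exists>\<delta>. F = halfspace n a \<delta> \<and> card {i. i < n \<and> a i \<noteq> 0} \<le> s)"

definition cutting_plane_paradigm ::
    "nat \<Rightarrow> ((nat \<Rightarrow> real) set \<Rightarrow> (nat \<Rightarrow> real) set set) \<Rightarrow> bool"
  where "cutting_plane_paradigm n P \<longleftrightarrow>
    (\<forall>C. closedin (Euclidean_space n) C \<and> convex_n C \<longrightarrow> (\<forall>F\<in>P C. cutting_plane n C F))"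


subsection \<open>The integer problem\<close>

definition C_set :: "nat \<Rightarrow> (nat \<Rightarrow> real) set"
  where "C_set n = {x \<in> Rn n. 2 * (\<Sum>i<n. x i) \<le> real n} \<inter> unit_cube n"

text \<open>The normal of the objective \<open>x\<^sub>1 + \<dots> + x\<^sub>k\<close>, where \<open>k = \<lceil>n/2\<rceil>\<close>.\<close>

definition obj :: "nat \<Rightarrow> nat \<Rightarrow> real"
  where "obj n = indicator {..<nat \<lceil>real n / 2\<rceil>}"

definition optimal_value ::
    "((nat \<Rightarrow> real) \<Rightarrow> real) \<Rightarrow> (nat \<Rightarrow> real) set \<Rightarrow> real \<Rightarrow> bool"
  where "optimal_value f S v \<longleftrightarrow> (\<exists>x\<in>S. f x = v) \<and> (\<forall>x\<in>S. f x \<le> v)"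

end

theory Submission
  imports Defs
begin

text \<open>
  Write \<open>n = 2 m + 1\<close>. Branching on \<open>x\<^sub>0, \<dots>, x\<^sub>m\<close> in turn gives a caterpillar: on a branch
  \<open>x\<^sub>i \<le> 0\<close> the objective is at most \<open>m\<close>, and the node where all \<open>m + 1\<close> of these variables are at
  least \<open>1\<close> is empty, because \<open>\<Sum> x\<^sub>i \<le> m + 1/2\<close> on \<open>C\<close>.
  On the other hand, a linear form with at most \<open>m\<close> non-zero coefficients attains its maximum over
  the cube at the indicator of its positive coefficients, and this point lies in \<open>C \<inter> \<int>\<^sup>n\<close>.
\<close>

lemma Rn_eq: "Rn n = {x. \<forall>i\<ge>n. x i = 0}"
  by (simp add: topspace_Euclidean_space)

lemma C_set_eq:
  "C_set n = {x \<in> Rn n. 2 * (\<Sum>i<n. x i) \<le> real n \<and> (\<forall>i<n. 0 \<le> x i \<and> x i \<le> 1)}"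
  by (auto simp: C_set_def unit_cube_def)

subsection \<open>Convexity and closedness\<close>

lemma convex_n_Int: "convex_n S \<Longrightarrow> convex_n T \<Longrightarrow> convex_n (S \<inter> T)"
  by (simp add: convex_n_def)

lemma convex_n_halfspace: "convex_n (halfspace n a \<delta>)"
proof -
  have "inner_n n a (\<lambda>i. u * x i + v * y i) \<le> \<delta>"
    if "inner_n n a x \<le> \<delta>" "inner_n n a y \<le> \<delta>" "0 \<le> u" "0 \<le> v" "u + v = 1" for x y u v
  proof -
    have "inner_n n a (\<lambda>i. u * x i + v * y i) = u * inner_n n a x + v * inner_n n a y"
      by (simp add: inner_n_def sum_distrib_left sum.distrib[symmetric] algebra_simps)
    also have "\<dots> \<le> \<delta>"
      using that by (rule convex_bound_le)
    finally show ?thesis .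
  qed
  then show ?thesis
    by (auto simp: convex_n_def halfspace_def Rn_eq)
qed

text \<open>With its counterpart for lower bounds, this reduces convexity of tree nodes to convexity
  of halfspaces.\<close>

lemma coordinate_le_eq_halfspace:
  assumes "i < n"
  shows "{x \<in> Rn n. x i \<le> b} = halfspace n (indicator {i}) b"
  using assms by (auto simp: halfspace_def inner_n_def indicator_def sum.delta if_distrib
    if_distribR cong: if_cong)

lemma coordinate_ge_eq_halfspace:
  assumes "i < n"
  shows "{x \<in> Rn n. b \<le> x i} = halfspace n (\<lambda>j. - indicator {i} j) (- b)"
proof -
  have "(\<Sum>j<n. - indicator {i} j * x j) = - x i" for x :: "nat \<Rightarrow> real"
    using assms by (simp add: sum_negf indicator_def if_distrib if_distribR cong: if_cong)
  then show ?thesis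
    by (auto simp: halfspace_def inner_n_def)
qed

lemma C_set_eq_halfspaces:
  "C_set n = halfspace n (\<lambda>_. 2) (real n) \<inter> unit_cube n"
  by (simp add: C_set_def halfspace_def inner_n_def sum_distrib_left)

lemma convex_n_unit_cube: "convex_n (unit_cube n)"
  unfolding convex_n_def unit_cube_def Rn_eq by (auto intro: convex_bound_le)

lemma convex_n_C_set: "convex_n (C_set n)"
  by (simp add: C_set_eq_halfspaces convex_n_Int convex_n_halfspace convex_n_unit_cube)

lemma continuous_map_coordinate:
  "continuous_map (Euclidean_space n) euclideanreal (\<lambda>x. x i)"
  unfolding Euclidean_space_def
  by (intro continuous_map_from_subtopology continuous_map_product_projection) simp

lemma closedin_halfspace: "closedin (Euclidean_space n) (halfspace n a \<delta>)"
proof -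
  have "continuous_map (Euclidean_space n) euclideanreal (inner_n n a)"
    unfolding inner_n_def
    by (intro continuous_map_sum continuous_map_real_mult continuous_map_coordinate) auto
  then have "closedin (Euclidean_space n) {x \<in> Rn n. inner_n n a x \<in> {..\<delta>}}"
    by (rule closedin_continuous_map_preimage) simp
  then show ?thesis
    by (simp add: halfspace_def)
qed

lemma closedin_unit_cube: "closedin (Euclidean_space n) (unit_cube n)"
proof -
  \<comment> \<open>Inserting \<open>Rn n\<close> keeps the family non-empty for
    \<open>n = 0\<close>, where the intersection must still be \<open>Rn n\<close>.\<close>
  have eq: "unit_cube n = \<Inter> (insert (Rn n) ((\<lambda>i. {x \<in> Rn n. x i \<in> {0..1}}) ` {..<n}))"
    by (auto simp: unit_cube_def)
  have "closedin (Euclidean_space n) {x \<in> Rn n. x i \<in> {0..1}}" for i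
    by (rule closedin_continuous_map_preimage[OF continuous_map_coordinate]) simp
  then show ?thesis
    unfolding eq by (intro closedin_Inter) auto
qed

lemma closedin_C_set: "closedin (Euclidean_space n) (C_set n)"
  by (simp add: C_set_eq_halfspaces closedin_Int closedin_halfspace closedin_unit_cube)

subsection \<open>The caterpillar tree\<close>

text \<open>Each branching uses \<pi>_0 = 0. Only the child with \<open>x i \<ge> 1\<close> is split
  again, so the size stays linear in the number of variables.\<close>

primrec caterpillar ::
    "nat \<Rightarrow> nat list \<Rightarrow> (nat \<Rightarrow> real) set \<Rightarrow> (nat \<Rightarrow> real) set rtree"
  where
    "caterpillar n [] N = Node N []"
  | "caterpillar n (i # is) N =
      Node N [Node ({x \<in> Rn n. x i \<le> 0} \<inter> N) [], caterpillar n is ({x \<in> Rn n. x i \<ge> 1} \<inter> N)]"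

lemma root_caterpillar [simp]: "root (caterpillar n is N) = N"
  by (cases "is") simp_all

lemma node_count_caterpillar: "node_count (caterpillar n is N) = 2 * length is + 1"
  by (induction "is" arbitrary: N) simp_all

lemma disjunction_variable:
  assumes "Qs \<in> variable_disjunctions n"
  shows "disjunction n Qs"
proof -
  obtain i and p :: int where i: "i < n"
    and Qs: "Qs = [{x \<in> Rn n. x i \<le> of_int p}, {x \<in> Rn n. x i \<ge> of_int p + 1}]"
    using assms by (auto simp: variable_disjunctions_def)
  have "x i \<le> of_int p \<or> of_int p + 1 \<le> x i" if "x \<in> Zn n" for x
  proof -
    from that i obtain k :: int where "x i = of_int k"
      by (auto simp: Zn_def elim: Ints_cases)
    then show ?thesis
      by (cases "k \<le> p") linarith+
  qed
  then show ?thesis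
    unfolding disjunction_def Qs by (auto simp: Zn_def)
qed

lemma branches_by_caterpillar:
  assumes "set is \<subseteq> {..<n}"
  shows "branches_by (variable_disjunctions n) (caterpillar n is N)"
  using assms
proof (induction "is" arbitrary: N)
  case (Cons i "is")
  \<comment> \<open>The terms keep \<open>of_int 0\<close> so that they match the set comprehension
    with \<pi>_0 = 0; simplification then yields the bounds 0 and 1.\<close>
  have "[{x \<in> Rn n. x i \<le> of_int 0}, {x \<in> Rn n. x i \<ge> of_int 0 + 1}] \<in> variable_disjunctions n"
    using Cons.prems unfolding variable_disjunctions_def by fastforce
  then show ?case
    using Cons by (auto intro!: bexI)
qed simp

lemma nodes_caterpillar:
  assumes "set is \<subseteq> {..<n}" "convex_n N" "M \<in> set_rtree (caterpillar n is N)"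
  shows "convex_n M \<and> M \<subseteq> N"
  using assms
proof (induction "is" arbitrary: N)
  case (Cons i "is")
  have "convex_n ({x \<in> Rn n. x i \<le> 0} \<inter> N)" "convex_n ({x \<in> Rn n. x i \<ge> 1} \<inter> N)"
    using Cons.prems
    by (simp_all add: coordinate_le_eq_halfspace coordinate_ge_eq_halfspace convex_n_Int
        convex_n_halfspace)
  with Cons.prems Cons.IH[of "{x \<in> Rn n. x i \<ge> 1} \<inter> N"] show ?case
    by auto
qed simp

text \<open>A leaf either hangs off the spine as the \<open>x i \<le> 0\<close> child of some
  branching or is the end of the spine. In the induction, the bound \<open>x i \<ge> 1\<close> of
  the head is carried down by membership in the shrunken \<open>N\<close>.\<close>

lemma leaves_caterpillar:
  assumes "M \<in> leaves (caterpillar n is N)" "x \<in> M"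
  shows "x \<in> N \<and> ((\<exists>i\<in>set is. x i \<le> 0) \<or> (\<forall>i\<in>set is. x i \<ge> 1))"
  using assms by (induction "is" arbitrary: N) fastforce+

lemma bb_tree_caterpillar:
  assumes "set is \<subseteq> {..<n}" "convex_n C"
  shows "bb_tree n (variable_disjunctions n) C (caterpillar n is C)"
  using assms by (simp add: bb_tree_def disjunction_variable branches_by_caterpillar
      nodes_caterpillar)

subsection \<open>The objective\<close>

lemma inner_n_obj:
  assumes "n = 2 * m + 1"
  shows "inner_n n (obj n) x = (\<Sum>i\<le>m. x i)"
proof -
  have "nat \<lceil>real n / 2\<rceil> = Suc m"
    using assms by (simp add: ceiling_eq_iff nat_eq_iff)
  then have "inner_n n (obj n) x = (\<Sum>i\<in>{..<n} \<inter> {..m}. x i)"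
    by (simp add: inner_n_def obj_def indicator_def lessThan_Suc_atMost flip: atMost_def)
  also have "{..<n} \<inter> {..m} = {..m}"
    using assms by auto
  finally show ?thesis .
qed

text \<open>The other \<open>m\<close> variables of the objective contribute at most 1 each.\<close>

lemma obj_le_if_coordinate_le_0:
  assumes "n = 2 * m + 1" "x \<in> C_set n" "i \<le> m" "x i \<le> 0"
  shows "inner_n n (obj n) x \<le> m"
proof -
  have "(\<Sum>j\<in>{..m} - {i}. x j) \<le> (\<Sum>j\<in>{..m} - {i}. 1)"
    using assms by (intro sum_mono) (auto simp: C_set_eq)
  also have "\<dots> = m"
    using assms by simp
  finally show ?thesis
    using assms sum.remove[of "{..m}" i x] by (simp add: inner_n_obj)
qed

text \<open>Otherwise these \<open>m + 1\<close> coordinates, the others being non-negative, would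
  force a total of at least \<open>m + 1 > n / 2\<close>. This serves both the empty last leaf and
  the integer optimum.\<close>

lemma C_set_coordinates_not_all_ge_1:
  assumes "n = 2 * m + 1" "x \<in> C_set n"
  shows "\<exists>i\<le>m. x i < 1"
proof (rule ccontr)
  assume "\<not> ?thesis"
  then have "(\<Sum>i\<le>m. 1) \<le> (\<Sum>i\<le>m. x i)"
    by (intro sum_mono) auto
  also have "\<dots> \<le> (\<Sum>i<n. x i)"
    using assms by (intro sum_mono2) (auto simp: C_set_eq)
  finally show False
    using assms by (simp add: C_set_eq)
qed

lemma certifies_caterpillar:
  assumes "n = 2 * m + 1"
  shows "certifies n (caterpillar n [0..<Suc m] (C_set n)) (obj n) m"
  unfolding certifies_def
proof (intro ballI)
  fix M x
  assume "M \<in> leaves (caterpillar n [0..<Suc m] (C_set n))" "x \<in> M"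
  from leaves_caterpillar[OF this]
  have x: "x \<in> C_set n" and "(\<exists>i\<le>m. x i \<le> 0) \<or> (\<forall>i\<le>m. x i \<ge> 1)"
    by (auto simp: less_Suc_eq_le simp del: upt_Suc)
  then obtain i where "i \<le> m" "x i \<le> 0"
    using C_set_coordinates_not_all_ge_1[OF assms x] by force
  then show "inner_n n (obj n) x \<le> m"
    using obj_le_if_coordinate_le_0[OF assms x] by simp
qed

text \<open>Source of feasible integer points: for a 0/1 point the knapsack constraint is just a
  bound on the size of its support.\<close>

lemma indicator_in_C_set_Zn:
  assumes "A \<subseteq> {..<n}" "2 * card A \<le> n"
  shows "indicator A \<in> C_set n \<inter> Zn n"
proof -
  have "(\<Sum>i<n. indicator A i) = real (card A)"
    using assms by (simp add: indicator_def Int_absorb1)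
  then show ?thesis
    using assms by (auto simp: C_set_eq Zn_def Rn_eq indicator_def)
qed

lemma optimal_value_obj:
  assumes "n = 2 * m + 1"
  shows "optimal_value (\<lambda>x. inner_n n (obj n) x) (C_set n \<inter> Zn n) m"
  unfolding optimal_value_def
proof (intro conjI ballI)
  \<comment> \<open>All \<open>m\<close> ones lie in the support \<open>{..m}\<close> of the
    objective, and \<open>2 * m \<le> n\<close> makes the point feasible.\<close>
  have "indicator {..<m} \<in> C_set n \<inter> Zn n"
    using assms by (intro indicator_in_C_set_Zn) auto
  moreover have "inner_n n (obj n) (indicator {..<m}) = m"
    using assms by (simp add: inner_n_obj indicator_def Int_absorb1 subset_eq flip: lessThan_def)
  ultimately show "\<exists>x\<in>C_set n \<inter> Zn n. inner_n n (obj n) x = m"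
    by blast
next
  fix x
  assume x: "x \<in> C_set n \<inter> Zn n"
  then obtain i where i: "i \<le> m" "x i < 1"
    using C_set_coordinates_not_all_ge_1[OF assms] by blast
  \<comment> \<open>Integrality sharpens \<open>x i < 1\<close> to \<open>x i \<le> 0\<close>, so
    the estimate used for the leaves applies.\<close>
  have "x i \<in> \<int>"
    using x i(1) assms by (simp add: Zn_def)
  then obtain k :: int where "x i = of_int k"
    by (rule Ints_cases)
  with i(2) have "x i \<le> 0"
    by simp
  then show "inner_n n (obj n) x \<le> m"
    using obj_le_if_coordinate_le_0[OF assms] x i by blast
qed

subsection \<open>Sparse cutting planes\<close>

lemma sparse_cut_trivial:
  assumes valid: "C_set n \<inter> Zn n \<subseteq> halfspace n a \<delta>"
    and sparse: "2 * card {i. i < n \<and> a i \<noteq> 0} \<le> n"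
  shows "unit_cube n \<subseteq> halfspace n a \<delta>"
proof
  fix x
  assume x: "x \<in> unit_cube n"
  \<comment> \<open>Sparsity enters through \<open>card A\<close> alone: it makes the cube's
    maximizer \<open>indicator A\<close> a feasible integer point, where the cut is known to
    hold.\<close>
  define A where "A = {i. i < n \<and> a i > 0}"
  have "card A \<le> card {i. i < n \<and> a i \<noteq> 0}"
    by (rule card_mono) (auto simp: A_def)
  with sparse have "indicator A \<in> C_set n \<inter> Zn n"
    by (intro indicator_in_C_set_Zn) (auto simp: A_def)
  with valid have "inner_n n a (indicator A) \<le> \<delta>"
    by (auto simp: halfspace_def)
  moreover have "inner_n n a x \<le> inner_n n a (indicator A)"
    unfolding inner_n_def
  proof (rule sum_mono)
    fix i
    assume "i \<in> {..<n}"
    \<comment> \<open>Termwise: positive coefficients use \<open>x i \<le> 1\<close>, the others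
      \<open>x i \<ge> 0\<close>.\<close>
    with x show "a i * x i \<le> a i * indicator A i"
      by (auto simp: A_def unit_cube_def indicator_def mult_left_le mult_nonpos_nonneg)
  qed
  ultimately show "x \<in> halfspace n a \<delta>"
    using x by (simp add: halfspace_def unit_cube_def)
qed

text \<open>The two assumptions may come with different inequalities for \<open>F\<close>. Since
  validity concerns the set \<open>F\<close> itself, the sparse representation can be used.\<close>

lemma sparse_cutting_plane_trivial:
  assumes "cutting_plane n (C_set n) F" "has_sparsity n s F" "2 * s \<le> n"
  shows "unit_cube n \<subseteq> F"
  using assms sparse_cut_trivial[of n]
  unfolding cutting_plane_def has_sparsity_def by fastforce

theorem theorem1p7:
  shows "\<exists>K :: real. \<forall>n :: nat. odd n \<longrightarrow>
    optimal_value (\<lambda>x. inner_n n (obj n) x) (C_set n \<inter> Zn n) (of_int \<lfloor>real n / 2\<rfloor>) \<and>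
    (\<exists>T. bb_tree n (variable_disjunctions n) (C_set n) T \<and>
         certifies n T (obj n) (of_int \<lfloor>real n / 2\<rfloor>) \<and>
         real (node_count T) \<le> K * real n) \<and>
    (\<forall>F s. cutting_plane n (C_set n) F \<and> has_sparsity n s F \<and> int s \<le> \<lfloor>real n / 2\<rfloor>
         \<longrightarrow> unit_cube n \<subseteq> F) \<and>
    (\<forall>P F s. cutting_plane_paradigm n P \<and> F \<in> P (C_set n) \<and>
         has_sparsity n s F \<and> int s \<le> \<lfloor>real n / 2\<rfloor>
         \<longrightarrow> unit_cube n \<subseteq> F) \<and>
    (\<forall>a\<in>Rn n. \<forall>\<delta>. C_set n \<inter> Zn n \<subseteq> halfspace n a \<delta> \<and>
         int (card {i. i < n \<and> a i \<noteq> 0}) \<le> \<lfloor>real n / 2\<rfloor>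
         \<longrightarrow> unit_cube n \<subseteq> halfspace n a \<delta>)"
\<comment> \<open>Branching on \<open>m + 1\<close> variables gives
  \<open>2 * (m + 1) + 1 = n + 2\<close> nodes, which is at most \<open>3 * n\<close> as
  \<open>n \<ge> 1\<close>, with equality at \<open>n = 1\<close>.\<close>
proof (intro exI[of _ 3] allI impI)
  fix n :: nat
  assume "odd n"
  then obtain m where n: "n = 2 * m + 1"
    by (rule oddE)
  then have floor: "\<lfloor>real n / 2\<rfloor> = int m"
    by linarith
  let ?T = "caterpillar n [0..<Suc m] (C_set n)"
  have "bb_tree n (variable_disjunctions n) (C_set n) ?T"
    using n by (intro bb_tree_caterpillar convex_n_C_set) auto
  moreover have "certifies n ?T (obj n) m"
    using n by (rule certifies_caterpillar)
  moreover have "real (node_count ?T) \<le> 3 * real n"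
    using n by (simp add: node_count_caterpillar del: upt_Suc)
  moreover have "unit_cube n \<subseteq> F"
    if "cutting_plane n (C_set n) F" "has_sparsity n s F" "int s \<le> int m" for F s
    using that n by (intro sparse_cutting_plane_trivial[of n F s]) auto
  \<comment> \<open>A paradigm is constrained only on closed convex sets, hence the appeal to both
    properties of \<open>C_set n\<close>.\<close>
  moreover have "cutting_plane n (C_set n) F"
    if "cutting_plane_paradigm n P" "F \<in> P (C_set n)" for P F
    using that closedin_C_set convex_n_C_set unfolding cutting_plane_paradigm_def by blast
  moreover have "unit_cube n \<subseteq> halfspace n a \<delta>"
    if "C_set n \<inter> Zn n \<subseteq> halfspace n a \<delta>" "int (card {i. i < n \<and> a i \<noteq> 0}) \<le> int m" for a \<delta>
    using that n by (intro sparse_cut_trivial) auto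
  ultimately show "optimal_value (\<lambda>x. inner_n n (obj n) x) (C_set n \<inter> Zn n) (of_int \<lfloor>real n / 2\<rfloor>) \<and>
    (\<exists>T. bb_tree n (variable_disjunctions n) (C_set n) T \<and>
         certifies n T (obj n) (of_int \<lfloor>real n / 2\<rfloor>) \<and>
         real (node_count T) \<le> 3 * real n) \<and>
    (\<forall>F s. cutting_plane n (C_set n) F \<and> has_sparsity n s F \<and> int s \<le> \<lfloor>real n / 2\<rfloor>
         \<longrightarrow> unit_cube n \<subseteq> F) \<and>
    (\<forall>P F s. cutting_plane_paradigm n P \<and> F \<in> P (C_set n) \<and>
         has_sparsity n s F \<and> int s \<le> \<lfloor>real n / 2\<rfloor>
         \<longrightarrow> unit_cube n \<subseteq> F) \<and>
    (\<forall>a\<in>Rn n. \<forall>\<delta>. C_set n \<inter> Zn n \<subseteq> halfspace n a \<delta> \<and>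
         int (card {i. i < n \<and> a i \<noteq> 0}) \<le> \<lfloor>real n / 2\<rfloor>
         \<longrightarrow> unit_cube n \<subseteq> halfspace n a \<delta>)"
    unfolding floor of_int_of_nat_eq using optimal_value_obj[OF n] by blast
qed

end
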